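(* Let $S=\{k^2:k\in\mathbb{N}\}$ and let $\bar S$ be its reciprocal. Let $n\in\mathbb{N}$. (1) If $n$ is even, then $n\in\bar S$ if and only if $n=2k^2$ for some $k\in\mathbb{N}$. (2) If $n\equiv1\pmod4$ and $n$ is not a perfect square, then $n\in\bar S$ if and only if $\nu_p(n)$ is even for every prime $p$ except exactly one prime $p_0$, and $p_0\equiv1\pmod 4$ and $\nu_{p_0}(n)\equiv1\pmod4$. (3) If $n\equiv1\pmod4$ and $n$ is a perfect square, then $n\in\bar S$ if and only if the number of primes $p\equiv1\pmod4$ with $\nu_p(n)\equiv2\pmod4$ is even.
   Context: $\mathbb{N}=\{0,1,2,\dots\}$. For $A\subseteq\mathbb{N}$ with $0\in A$, the reciprocal $\bar A$ is the unique set $B\subseteq\mathbb{N}$ with $\big(\sum_{a\in A}q^a\big)\big(\sum_{b\in B}q^b\big)=1$ in $\mathbb{F}_2[[q]]$; equivalently every positive integer has an even number of representations $a+b$ with $a\in A$, $b\in B$. For a prime $p$ and positive integer $n$, $\nu_p(n)$ is the exponent of $p$ in the prime factorization of $n$. *)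

theory Defs
  imports
    "HOL-Library.Z2"
    "HOL-Computational_Algebra.Formal_Power_Series"
    "HOL-Number_Theory.Number_Theory"
begin

text \<open>The type \<open>bit\<close> is the two-element field, so \<open>bit fps\<close> is
  the ring of formal power series over it.\<close>

definition gen_series :: "nat set \<Rightarrow> bit fps" where
  "gen_series A = Abs_fps (\<lambda>n. if n \<in> A then 1 else 0)"

text \<open>Meaningful only if \<open>0 \<in> A\<close>; see \<open>reciprocal_ex1\<close> below.\<close>

definition reciprocal :: "nat set \<Rightarrow> nat set" where
  "reciprocal A = (THE B. gen_series A * gen_series B = 1)"

lemma gen_series_support: "gen_series {n. fps_nth f n = 1} = f"
  by (rule fps_ext) (simp add: gen_series_def)

lemma gen_series_inject: "gen_series A = gen_series B \<longleftrightarrow> A = B"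
proof
  assume eq: "gen_series A = gen_series B"
  have "n \<in> A \<longleftrightarrow> n \<in> B" for n
    using arg_cong[OF eq, of "\<lambda>f. fps_nth f n"]
    by (simp add: gen_series_def split: if_splits)
  then show "A = B" by blast
qed simp

lemma reciprocal_ex1:
  assumes "0 \<in> A"
  shows "\<exists>!B. gen_series A * gen_series B = 1"
proof
  have "fps_nth (gen_series A) 0 \<noteq> 0"
    using assms by (simp add: gen_series_def)
  then have inv: "gen_series A * inverse (gen_series A) = 1"
    by (rule inverse_mult_eq_1')
  show "gen_series A * gen_series {n. fps_nth (inverse (gen_series A)) n = 1} = 1"
    by (simp only: gen_series_support inv)
  fix B assume "gen_series A * gen_series B = 1"
  then have "gen_series B = inverse (gen_series A)"
    by (rule fps_inverse_unique[symmetric])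
  then have "gen_series B = gen_series {n. fps_nth (inverse (gen_series A)) n = 1}"
    by (simp only: gen_series_support)
  then show "B = {n. fps_nth (inverse (gen_series A)) n = 1}"
    by (simp only: gen_series_inject)
qed

lemma gen_series_reciprocal:
  assumes "0 \<in> A"
  shows "gen_series A * gen_series (reciprocal A) = 1"
  unfolding reciprocal_def using reciprocal_ex1[OF assms] by (rule theI')

end

theory Submission
  imports Defs
begin

text \<open>
  Let \<open>F\<close> be the series of the squares and \<open>R\<close> its inverse. Squaring is \<open>q \<mapsto> q\<^sup>2\<close> in
  characteristic 2, so \<open>F = G + F^4\<close> with \<open>G\<close> the series of the odd squares, whence
  \<open>R = (F R) R = G R\<^sup>2 + F\<^sup>2\<close>. Parity of exponents gives the even part \<open>F\<^sup>2\<close> of \<open>R\<close>; substituting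
  once more, \<open>G R\<^sup>2 = G\<^sup>3 R^4 + G F^4\<close>, where the first term lives on exponents congruent to 3
  modulo 4. So for \<open>n\<close> congruent to 1 modulo 4 the coefficient of \<open>R\<close> is the parity of the number
  of representations \<open>n = x\<^sup>2 + 4 y\<^sup>2\<close>.

  That parity needs no two-squares theorem. The solutions with \<open>y > 0\<close> are the fixed points of
  \<open>(x, y, z) \<mapsto> (x, z, y)\<close> on the positive solutions of \<open>x\<^sup>2 + 4 y z = n\<close>, while the fixed points of
  Zagier's involution on the same set correspond to the divisors \<open>d\<close> of \<open>n\<close> with \<open>d\<^sup>2 < n\<close>. If
  \<open>n = m\<^sup>2\<close>, there are \<open>(m - 1) / 2\<close> further triples that Zagier's map sends outside the set. With \<open>\<tau>\<close>
  the number of divisors, the count is odd iff \<open>\<tau> n\<close> is 2 modulo 4 for non-squares, and iff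
  \<open>m * \<tau> (m\<^sup>2)\<close> is 1 modulo 4 for \<open>n = m\<^sup>2\<close>.
\<close>

section \<open>Power series over the two-element field\<close>

text \<open>The points moved by \<open>f\<close> split into orbits of size two. The induction strips
  off one orbit \<open>{a, f a}\<close> at a time, which changes neither the parity nor the set of
  fixed points.\<close>

lemma even_card_involution:
  assumes "finite A" and "\<And>x. x \<in> A \<Longrightarrow> f x \<in> A" and "\<And>x. x \<in> A \<Longrightarrow> f (f x) = x"
  shows "even (card A) \<longleftrightarrow> even (card {x \<in> A. f x = x})"
  using assms
proof (induction A rule: finite_psubset_induct)
  case (psubset A)
  show ?case
  proof (cases "\<forall>x \<in> A. f x = x")
    case True
    then have "{x \<in> A. f x = x} = A" by auto
    then show ?thesis by simp
  next
    case False
    then obtain a where a: "a \<in> A" "f a \<noteq> a" by auto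
    define B where "B = A - {a, f a}"
    have B: "B \<subset> A" using a by (auto simp: B_def)
    have A: "A = insert a (insert (f a) B)" "a \<notin> B" "f a \<notin> B"
      using a psubset.prems by (auto simp: B_def)
    have "f x \<in> B" if "x \<in> B" for x
      using that a psubset.prems unfolding B_def by (metis Diff_iff insert_iff empty_iff)
    then have "even (card B) \<longleftrightarrow> even (card {x \<in> B. f x = x})"
      using psubset.IH[OF B] psubset.prems B by blast
    moreover have "{x \<in> B. f x = x} = {x \<in> A. f x = x}"
      using a psubset.prems by (auto simp: B_def)
    moreover have "card A = card B + 2"
      using A a(2) psubset.hyps finite_subset[of B A] B by auto
    ultimately show ?thesis by simp
  qed
qed

lemma gen_series_mult_nth:
  "fps_nth (gen_series A * gen_series B) n = of_nat (card {(a, b). a \<in> A \<and> b \<in> B \<and> a + b = n})"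
proof -
  have "{(a, b). a \<in> A \<and> b \<in> B \<and> a + b = n} = (\<lambda>i. (i, n - i)) ` {i \<in> {0..n}. i \<in> A \<and> n - i \<in> B}"
    by (auto simp: image_iff)
  moreover have "inj_on (\<lambda>i. (i, n - i)) {i \<in> {0..n}. i \<in> A \<and> n - i \<in> B}"
    by (auto simp: inj_on_def)
  ultimately have "card {(a, b). a \<in> A \<and> b \<in> B \<and> a + b = n} = card {i \<in> {0..n}. i \<in> A \<and> n - i \<in> B}"
    by (simp add: card_image)
  moreover have "fps_nth (gen_series A * gen_series B) n
      = (\<Sum>i\<in>{0..n}. if i \<in> A \<and> n - i \<in> B then 1 else 0)"
    unfolding fps_mult_nth by (intro sum.cong) (auto simp: gen_series_def)
  ultimately show ?thesis
    by (simp add: sum.If_cases Int_def)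
qed

lemma of_nat_bit_eq_1_iff: "(of_nat k :: bit) = 1 \<longleftrightarrow> odd k"
  by (induction k) auto

text \<open>Swapping the summands pairs off the representations \<open>a + b = n\<close> with
  \<open>a\<close> different from \<open>b\<close>, so modulo 2 only \<open>a + a\<close> survives.
  This is the Frobenius map, read as a dilation of the exponent set.\<close>

lemma gen_series_power2: "(gen_series A)\<^sup>2 = gen_series ((*) 2 ` A)"
proof (rule fps_ext)
  fix n
  let ?P = "{(a, b). a \<in> A \<and> b \<in> A \<and> a + b = n}"
  have "finite ?P" by (rule finite_subset[of _ "{..n} \<times> {..n}"]) auto
  then have parity: "even (card ?P) \<longleftrightarrow> even (card {x \<in> ?P. prod.swap x = x})"
    by (rule even_card_involution) auto
  have diag: "{x \<in> ?P. prod.swap x = x} = (\<lambda>a. (a, a)) ` {a \<in> A. n = 2 * a}"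
  proof (intro subset_antisym subsetI)
    fix x assume "x \<in> {x \<in> ?P. prod.swap x = x}"
    then have P: "x \<in> ?P" and swap: "prod.swap x = x" by blast+
    from swap have "snd x = fst x" by (metis fst_swap)
    moreover from this have "x = (fst x, fst x)" by (metis prod.collapse)
    moreover from P have "fst x \<in> A" "fst x + snd x = n" by auto
    ultimately show "x \<in> (\<lambda>a. (a, a)) ` {a \<in> A. n = 2 * a}" by (intro image_eqI[of _ _ "fst x"]) auto
  qed (auto simp: mult_2)
  have "odd (card ?P) \<longleftrightarrow> n \<in> (*) 2 ` A"
  proof (cases "n \<in> (*) 2 ` A")
    case True
    then obtain a where "n = 2 * a" "a \<in> A" by blast
    then have "{b \<in> A. n = 2 * b} = {a}" by auto
    with parity diag True show ?thesis by (simp del: Collect_conv_if)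
  next
    case False
    then have "{b \<in> A. n = 2 * b} = {}" by blast
    with parity diag False show ?thesis by (simp only: image_empty card.empty) simp
  qed
  then show "fps_nth ((gen_series A)\<^sup>2) n = fps_nth (gen_series ((*) 2 ` A)) n"
    unfolding power2_eq_square gen_series_mult_nth
    using of_nat_bit_eq_1_iff[of "card ?P"] by (cases "n \<in> (*) 2 ` A") (simp_all add: gen_series_def)
qed

text \<open>The grading of the power series ring by residues of exponents: residues add under
  multiplication, so a coefficient outside the resulting class must vanish.\<close>

definition supported_mod :: "nat \<Rightarrow> nat \<Rightarrow> 'a::zero fps \<Rightarrow> bool" where
  "supported_mod m r f \<longleftrightarrow> (\<forall>n. fps_nth f n \<noteq> 0 \<longrightarrow> [n = r] (mod m))"

lemma supported_mod_mult:
  fixes f g :: "'a::semiring_0 fps"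
  assumes "supported_mod m r f" "supported_mod m s g"
  shows "supported_mod m (r + s) (f * g)"
  unfolding supported_mod_def
proof (intro allI impI)
  fix n assume "fps_nth (f * g) n \<noteq> 0"
  then have "(\<Sum>i=0..n. fps_nth f i * fps_nth g (n - i)) \<noteq> 0" by (simp add: fps_mult_nth)
  then obtain i where i: "i \<in> {0..n}" "fps_nth f i * fps_nth g (n - i) \<noteq> 0"
    by (meson sum.neutral)
  then have "fps_nth f i \<noteq> 0" "fps_nth g (n - i) \<noteq> 0" by auto
  then have "[i + (n - i) = r + s] (mod m)"
    using assms unfolding supported_mod_def by (intro cong_add) auto
  then show "[n = r + s] (mod m)" using i by simp
qed

lemma supported_mod_gen_series:
  "supported_mod m r (gen_series A) \<longleftrightarrow> (\<forall>a\<in>A. [a = r] (mod m))"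
  by (auto simp: supported_mod_def gen_series_def)

lemma odd_square_mod_4:
  assumes "odd (k::nat)"
  shows "k\<^sup>2 mod 4 = 1"
proof -
  obtain j where "k = 2 * j + 1" using assms by (rule oddE)
  then have "k\<^sup>2 = 1 + 4 * (j\<^sup>2 + j)" by (simp add: power2_eq_square algebra_simps)
  then show ?thesis by simp
qed

lemma double_bit_fps: "(f :: bit fps) + f = 0"
proof (rule fps_ext)
  fix n
  show "fps_nth (f + f) n = fps_nth 0 n"
    unfolding fps_add_nth fps_zero_nth by (cases "fps_nth f n") simp_all
qed

lemma bit_fps_add_power2: "(f + g :: bit fps)\<^sup>2 = f\<^sup>2 + g\<^sup>2"
proof -
  have "(f + g)\<^sup>2 = f\<^sup>2 + g\<^sup>2 + (f * g + f * g)"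
    by (simp only: power2_eq_square distrib_left distrib_right mult.commute[of g f] add_ac)
  then show ?thesis by (simp add: double_bit_fps)
qed

lemma gen_series_nth: "fps_nth (gen_series A) n = 1 \<longleftrightarrow> n \<in> A"
  by (simp add: gen_series_def)

section \<open>The reciprocal of the set of squares\<close>

context
  fixes S :: "nat set"
  assumes S_def: "S = {k\<^sup>2 | k :: nat. True}"
begin

text \<open>An even square is four times a square, and dilating the exponents by 4 is squaring the
  series twice.\<close>

lemma gen_series_squares_decomp:
  "gen_series S = gen_series {s \<in> S. odd s} + (gen_series S)^4"
proof -
  have even: "{s \<in> S. even s} = (*) 2 ` (*) 2 ` S"
  proof (intro subset_antisym subsetI)
    fix s assume "s \<in> {s \<in> S. even s}"
    then obtain k where "s = k\<^sup>2" "even k" by (auto simp: S_def)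
    then obtain j where "s = 2 * (2 * j\<^sup>2)" by (auto simp: power2_eq_square elim!: evenE)
    then show "s \<in> (*) 2 ` (*) 2 ` S" by (auto simp: S_def)
  next
    fix s assume "s \<in> (*) 2 ` (*) 2 ` S"
    then obtain k where "s = (2 * k)\<^sup>2" by (auto simp: S_def power_mult_distrib)
    moreover from this have "s \<in> S" unfolding S_def by blast
    ultimately show "s \<in> {s \<in> S. even s}" by simp
  qed
  have "(gen_series S)^4 = ((gen_series S)\<^sup>2)\<^sup>2" by (simp flip: power_mult)
  also have "\<dots> = gen_series {s \<in> S. even s}" by (simp add: gen_series_power2 even)
  finally show ?thesis by (intro fps_ext) (auto simp: gen_series_def)
qed

text \<open>Multiply the decomposition of \<open>F\<close> by \<open>R\<^sup>2\<close>: the left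
  side collapses to \<open>R\<close>, and \<open>F^4 * R\<^sup>2\<close> to
  \<open>F\<^sup>2\<close>.\<close>

lemma inverse_eq_of_self_decomp:
  fixes F G R :: "bit fps"
  assumes "F * R = 1" "F = G + F^4"
  shows "R = G * R\<^sup>2 + F\<^sup>2"
proof -
  have "R = (G + F^4) * R\<^sup>2"
    using assms by (metis mult.assoc mult.commute mult.right_neutral power2_eq_square)
  also have "\<dots> = G * R\<^sup>2 + F\<^sup>2 * (F * R)\<^sup>2"
    by (simp add: algebra_simps power2_eq_square numeral_eq_Suc)
  finally show ?thesis using assms(1) by simp
qed

lemma
  shows even_mem_reciprocal_squares:
    "even n \<Longrightarrow> n \<in> reciprocal S \<longleftrightarrow> (\<exists>k. n = 2 * k\<^sup>2)"
  and mem_reciprocal_squares_1_mod_4: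
    "[n = 1] (mod 4) \<Longrightarrow> n \<in> reciprocal S \<longleftrightarrow> odd (card {(x, y). x\<^sup>2 + 4 * y\<^sup>2 = n})"
proof -
  define F where "F = gen_series S"
  define R where "R = gen_series (reciprocal S)"
  define G where "G = gen_series {s \<in> S. odd s}"
  have "0 \<in> S" by (auto simp: S_def)
  then have "F * R = 1" unfolding F_def R_def by (rule gen_series_reciprocal)
  moreover have "F = G + F^4" unfolding F_def G_def by (rule gen_series_squares_decomp)
  ultimately have R: "R = G * R\<^sup>2 + F\<^sup>2" by (rule inverse_eq_of_self_decomp)
  have F4: "F^4 = (F\<^sup>2)\<^sup>2" "R^4 = (R\<^sup>2)\<^sup>2" by (simp_all flip: power_mult)
  have G4: "supported_mod 4 1 G"
    unfolding G_def supported_mod_gen_series by (auto simp: S_def cong_def odd_square_mod_4)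
  have G2: "supported_mod 2 1 G"
    unfolding G_def supported_mod_gen_series by (auto simp: cong_def odd_iff_mod_2_eq_one)
  have R2: "supported_mod 2 0 (R\<^sup>2)"
    unfolding R_def gen_series_power2 supported_mod_gen_series by (auto simp: cong_def)
  have R4: "supported_mod 4 0 (R^4)"
    unfolding F4 unfolding R_def gen_series_power2 supported_mod_gen_series by (auto simp: cong_def)
  have mem: "n \<in> reciprocal S \<longleftrightarrow> fps_nth (G * R\<^sup>2) n + fps_nth (F\<^sup>2) n = 1" for n
    using R by (metis R_def gen_series_nth fps_add_nth)
  show "n \<in> reciprocal S \<longleftrightarrow> (\<exists>k. n = 2 * k\<^sup>2)" if "even n"
  proof -
    \<comment> \<open>\<open>G\<close> lives on odd exponents and \<open>R\<^sup>2\<close> on even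
      ones, so the product has odd exponents only.\<close>
    have "fps_nth (G * R\<^sup>2) n = 0"
      using supported_mod_mult[OF G2 R2] that
      unfolding supported_mod_def cong_def by (auto simp: even_iff_mod_2_eq_zero)
    then have "n \<in> reciprocal S \<longleftrightarrow> n \<in> (*) 2 ` S"
      unfolding mem by (simp only: add_0 F_def gen_series_power2 gen_series_nth)
    then show ?thesis by (auto simp: S_def)
  qed
  show "n \<in> reciprocal S \<longleftrightarrow> odd (card {(x, y). x\<^sup>2 + 4 * y\<^sup>2 = n})" if n: "[n = 1] (mod 4)"
  proof -
    have "odd n" using n by (simp add: cong_def) presburger
    then have "fps_nth (F\<^sup>2) n = 0"
      unfolding F_def gen_series_power2 by (auto simp: gen_series_def)
    \<comment> \<open>The equation for \<open>R\<close>, squared by Frobenius, is substituted for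
      \<open>R\<^sup>2\<close>.\<close>
    moreover have "G * R\<^sup>2 = G * (G * G) * R^4 + G * F^4"
    proof -
      have "R\<^sup>2 = (G * R\<^sup>2)\<^sup>2 + F^4"
        by (subst (1) R) (simp only: bit_fps_add_power2 F4)
      then have "G * R\<^sup>2 = G * ((G * R\<^sup>2)\<^sup>2 + F^4)" by (rule arg_cong)
      also have "\<dots> = G * (G * G) * R^4 + G * F^4"
        unfolding F4(2) by (simp add: distrib_left power2_eq_square mult_ac)
      finally show ?thesis .
    qed
    \<comment> \<open>The exponents here are congruent to 1 + 1 + 1 + 0 = 3 modulo 4, whereas
      \<open>n\<close> is congruent to 1.\<close>
    moreover have "fps_nth (G * (G * G) * R^4) n = 0"
      using supported_mod_mult[OF supported_mod_mult[OF G4 supported_mod_mult[OF G4 G4]] R4] n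
      unfolding supported_mod_def cong_def by auto
    ultimately have "n \<in> reciprocal S \<longleftrightarrow> fps_nth (G * F^4) n = 1"
      unfolding mem by simp
    also have "\<dots> \<longleftrightarrow> odd (card {(a, b). a \<in> {s \<in> S. odd s} \<and> b \<in> (*) 2 ` (*) 2 ` S \<and> a + b = n})"
      unfolding F4 unfolding F_def gen_series_power2 G_def gen_series_mult_nth of_nat_bit_eq_1_iff ..
    \<comment> \<open>Square roots of naturals are unique, so counting pairs of values is counting
      pairs \<open>(x, y)\<close>. Oddness of \<open>n\<close> makes \<open>x\<^sup>2\<close>
      odd.\<close>
    also have "{(a, b). a \<in> {s \<in> S. odd s} \<and> b \<in> (*) 2 ` (*) 2 ` S \<and> a + b = n}
        = (\<lambda>(x, y). (x\<^sup>2, 4 * y\<^sup>2)) ` {(x, y). x\<^sup>2 + 4 * y\<^sup>2 = n}" (is "?A = ?f ` ?B")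
    proof (intro subset_antisym subsetI)
      fix t assume "t \<in> ?A"
      then obtain x y where "t = (x\<^sup>2, 2 * (2 * y\<^sup>2))" "x\<^sup>2 + 2 * (2 * y\<^sup>2) = n" by (auto simp: S_def)
      then have "t = ?f (x, y)" "(x, y) \<in> ?B" by auto
      then show "t \<in> ?f ` ?B" by (rule image_eqI)
    next
      fix t assume "t \<in> ?f ` ?B"
      then obtain x y where t: "t = (x\<^sup>2, 2 * (2 * y\<^sup>2))" "x\<^sup>2 + 2 * (2 * y\<^sup>2) = n" by auto
      then have "odd (x\<^sup>2)" using \<open>odd n\<close> by auto
      then show "t \<in> ?A" using t unfolding S_def by blast
    qed
    also have "card (?f ` ?B) = card ?B"
      by (intro card_image) (auto simp: inj_on_def)
    finally show ?thesis .
  qed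
qed

end

section \<open>Divisors\<close>

text \<open>By unique factorization, divisors correspond to exponent functions bounded by those of
  \<open>n\<close>. \<open>restrict\<close> fixes the values off the primes of \<open>n\<close>, as
  membership in \<open>PiE\<close> demands.\<close>

lemma card_divisors:
  assumes "n > (0::nat)"
  shows "card {d. d dvd n} = (\<Prod>p\<in>prime_factors n. multiplicity p n + 1)"
proof -
  let ?P = "prime_factors n"
  let ?E = "PiE ?P (\<lambda>p. {..multiplicity p n})"
  have fin: "finite ?P" by simp
  have "bij_betw (\<lambda>f. \<Prod>p\<in>?P. p ^ f p) ?E {d. d dvd n}"
  proof (rule bij_betw_byWitness[where f' = "\<lambda>d. restrict (\<lambda>p. multiplicity p d) ?P"])
    show "\<forall>f\<in>?E. restrict (\<lambda>p. multiplicity p (\<Prod>p\<in>?P. p ^ f p)) ?P = f"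
    proof
      fix f assume f: "f \<in> ?E"
      have "multiplicity p (\<Prod>p\<in>?P. p ^ f p) = f p" if "p \<in> ?P" for p
        using that by (subst multiplicity_prod_prime_powers) auto
      then show "restrict (\<lambda>p. multiplicity p (\<Prod>p\<in>?P. p ^ f p)) ?P = f"
        using f by (auto simp: fun_eq_iff PiE_def extensional_def)
    qed
    show "\<forall>d\<in>{d. d dvd n}. (\<Prod>p\<in>?P. p ^ restrict (\<lambda>p. multiplicity p d) ?P p) = d"
    proof
      fix d assume "d \<in> {d. d dvd n}"
      then have d: "d dvd n" "d > 0" using assms by (auto intro: Nat.gr0I)
      have "(\<Prod>p\<in>?P. p ^ restrict (\<lambda>p. multiplicity p d) ?P p) = (\<Prod>p\<in>?P. p ^ multiplicity p d)"
        by (intro prod.cong) auto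
      also have "\<dots> = (\<Prod>p\<in>prime_factors d. p ^ multiplicity p d)"
      proof (intro prod.mono_neutral_right)
        show "prime_factors d \<subseteq> ?P"
          using d assms by (intro dvd_prime_factors) auto
        show "\<forall>p\<in>?P - prime_factors d. p ^ multiplicity p d = 1"
          by (auto simp: prime_factors_multiplicity)
      qed simp
      also have "\<dots> = d" using d by (simp add: prod_prime_factors)
      finally show "(\<Prod>p\<in>?P. p ^ restrict (\<lambda>p. multiplicity p d) ?P p) = d" .
    qed
    show "(\<lambda>f. \<Prod>p\<in>?P. p ^ f p) ` ?E \<subseteq> {d. d dvd n}"
    proof safe
      fix f assume f: "f \<in> ?E"
      have "(\<Prod>p\<in>?P. p ^ f p) dvd (\<Prod>p\<in>?P. p ^ multiplicity p n)"
        using f by (intro prod_dvd_prod le_imp_power_dvd) auto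
      also have "\<dots> = n" using assms by (simp add: prod_prime_factors)
      finally show "(\<Prod>p\<in>?P. p ^ f p) dvd n" .
    qed
    show "(\<lambda>d. restrict (\<lambda>p. multiplicity p d) ?P) ` {d. d dvd n} \<subseteq> ?E"
      using assms by (auto intro!: dvd_imp_multiplicity_le)
  qed
  then have "card {d. d dvd n} = card ?E" by (simp add: bij_betw_same_card)
  also have "\<dots> = (\<Prod>p\<in>?P. multiplicity p n + 1)" by (simp add: card_PiE)
  finally show ?thesis .
qed

text \<open>The map from \<open>d\<close> to \<open>n div d\<close> exchanges the divisors below and
  above the square root of \<open>n\<close>.\<close>

lemma card_divisors_below_sqrt:
  assumes "n > (0::nat)"
  shows "card {d. d dvd n} = 2 * card {d. d dvd n \<and> d\<^sup>2 < n} + card {d. d\<^sup>2 = n}"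
proof -
  let ?L = "{d. d dvd n \<and> d\<^sup>2 < n}" and ?U = "{d. d dvd n \<and> n < d\<^sup>2}" and ?M = "{d. d\<^sup>2 = n}"
  have fin: "finite {d. d dvd n}" using assms by simp
  have flip: "(n div d)\<^sup>2 < n \<longleftrightarrow> n < d\<^sup>2" "n < (n div d)\<^sup>2 \<longleftrightarrow> d\<^sup>2 < n" if dn: "d dvd n" for d
  proof -
    obtain e where "n = d * e" using dn by blast
    then show "(n div d)\<^sup>2 < n \<longleftrightarrow> n < d\<^sup>2" "n < (n div d)\<^sup>2 \<longleftrightarrow> d\<^sup>2 < n"
      using assms by (auto simp: power2_eq_square)
  qed
  have "bij_betw (\<lambda>d. n div d) ?L ?U"
    using assms by (intro bij_betw_byWitness[where f' = "\<lambda>d. n div d"]) (auto simp: flip)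
  then have "card ?L = card ?U" by (rule bij_betw_same_card)
  moreover have split: "{d. d dvd n} = ?L \<union> ?U \<union> ?M"
    by (auto simp: power2_eq_square)
  moreover have "card (?L \<union> ?U \<union> ?M) = card ?L + card ?U + card ?M"
  proof -
    have "finite ?L" "finite ?U" using fin by simp_all
    moreover have "finite ?M" by (rule finite_subset[OF _ fin]) (auto simp: power2_eq_square)
    moreover have "?L \<inter> ?U = {}" "(?L \<union> ?U) \<inter> ?M = {}" by auto
    ultimately show ?thesis by (simp add: card_Un_disjoint)
  qed
  ultimately show ?thesis by presburger
qed

section \<open>Zagier's involution\<close>

text \<open>The triples of Zagier's one-sentence proof of the two-squares theorem for primes, here
  for arbitrary \<open>n\<close>.\<close>

definition zagier_set :: "nat \<Rightarrow> (nat \<times> nat \<times> nat) set" where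
  "zagier_set n = {(x, y, z). 0 < x \<and> 0 < y \<and> 0 < z \<and> x\<^sup>2 + 4 * y * z = n}"

text \<open>The first and third branches undo each other on the interior, and the middle one undoes
  itself. Conditions and coordinates are arranged so that no subtraction is truncated in the branch
  where it occurs.\<close>

fun zagier_map :: "nat \<times> nat \<times> nat \<Rightarrow> nat \<times> nat \<times> nat" where
  "zagier_map (x, y, z) =
    (if x + z < y then (x + 2 * z, z, y - x - z)
     else if x < 2 * y then (2 * y - x, y, x + z - y)
     else (x - 2 * y, x + z - y, y))"

lemma finite_zagier_set: "finite (zagier_set n)"
proof (rule finite_subset)
  have "x \<le> n \<and> y \<le> n \<and> z \<le> n" if "0 < x" "0 < y" "0 < z" "x\<^sup>2 + 4 * y * z = n" for x y z :: nat
  proof -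
    have "x \<le> x\<^sup>2" "y \<le> y * z" "z \<le> y * z" using that by (auto simp: power2_eq_square)
    then show ?thesis using that by linarith
  qed
  then show "zagier_set n \<subseteq> {..n} \<times> {..n} \<times> {..n}"
    unfolding zagier_set_def by auto
qed simp

lemma even_card_zagier_set_swap:
  "even (card (zagier_set n)) \<longleftrightarrow> even (card {(x, y). 0 < x \<and> 0 < y \<and> x\<^sup>2 + 4 * y\<^sup>2 = n})"
proof -
  let ?f = "\<lambda>(x::nat, y::nat, z::nat). (x, z, y)"
  have "even (card (zagier_set n)) \<longleftrightarrow> even (card {t \<in> zagier_set n. ?f t = t})"
    using finite_zagier_set by (rule even_card_involution) (auto simp: zagier_set_def mult_ac)
  also have "{t \<in> zagier_set n. ?f t = t}
      = (\<lambda>(x, y). (x, y, y)) ` {(x, y). 0 < x \<and> 0 < y \<and> x\<^sup>2 + 4 * y\<^sup>2 = n}"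
    by (auto simp: zagier_set_def power2_eq_square image_iff)
  also have "card \<dots> = card {(x, y). 0 < x \<and> 0 < y \<and> x\<^sup>2 + 4 * y\<^sup>2 = n}"
    by (intro card_image) (auto simp: inj_on_def)
  finally show ?thesis .
qed

text \<open>On the boundary \<open>x + z = y\<close> the last coordinate of \<open>zagier_map (x, y, z)\<close> is
  zero, so the map leaves \<open>zagier_set n\<close>. Such triples exist only when \<open>n\<close> is a square.\<close>

lemma zagier_map_involution:
  assumes "odd n" and t: "t \<in> {(x, y, z) \<in> zagier_set n. x + z \<noteq> y}"
  shows "zagier_map t \<in> {(x, y, z) \<in> zagier_set n. x + z \<noteq> y} \<and> zagier_map (zagier_map t) = t"
proof -
  obtain x y z where [simp]: "t = (x, y, z)" by (cases t)
  have xyz: "0 < x" "0 < y" "0 < z" "x\<^sup>2 + 4 * y * z = n" "x + z \<noteq> y"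
    using t by (auto simp: zagier_set_def)
  have "x \<noteq> 2 * y" using \<open>odd n\<close> xyz(4) by auto
  then consider "x + z < y" | "y < x + z" "x < 2 * y" | "y < x + z" "2 * y < x"
    using xyz(5) by linarith
  then show ?thesis
  proof cases
    case 1
    then obtain w where "y = x + z + w" "0 < w" using less_imp_add_positive by blast
    then show ?thesis using xyz
      by (auto simp: zagier_set_def power2_eq_square algebra_simps)
  next
    case 2
    then obtain w v where wv: "x + z = y + w" "0 < w" "2 * y = x + v" "0 < v"
      using less_imp_add_positive by metis
    \<comment> \<open>Over the integers \<open>v\<close> and \<open>w\<close> are genuine
      differences, so the invariance of the form is a polynomial identity.\<close>
    have "int v ^ 2 + 4 * int y * int w = int x ^ 2 + 4 * int y * int z"
    proof -
      have v: "int v = 2 * int y - int x" and w: "int w = int x + int z - int y" using wv by linarith+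
      show ?thesis unfolding v w by (simp add: power2_eq_square algebra_simps)
    qed
    then have "v\<^sup>2 + 4 * y * w = n" using xyz(4)
      by (metis (mono_tags) of_nat_eq_iff of_nat_add of_nat_mult of_nat_power of_nat_numeral)
    moreover have "zagier_map t = (v, y, w)" "zagier_map (v, y, w) = t" "v + w \<noteq> y"
      using wv xyz by auto
    ultimately show ?thesis using wv xyz by (simp add: zagier_set_def)
  next
    case 3
    then obtain w where "x = 2 * y + w" "0 < w" using less_imp_add_positive by blast
    then show ?thesis using xyz
      by (auto simp: zagier_set_def power2_eq_square algebra_simps)
  qed
qed

text \<open>A fixed point has \<open>y = x\<close>, so \<open>n = x * (x + 4 * z)\<close> and
  \<open>x\<close> is the smaller of two complementary divisors. Conversely, complementary divisors
  of such an \<open>n\<close> are both 1 or both 3 modulo 4, so their difference is a multiple of 4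
  and yields \<open>z\<close>.\<close>

lemma zagier_map_fixed_points:
  assumes n: "[n = 1] (mod 4)"
  shows "card {t \<in> {(x, y, z) \<in> zagier_set n. x + z \<noteq> y}. zagier_map t = t} = card {d. d dvd n \<and> d\<^sup>2 < n}"
proof -
  have "{t \<in> {(x, y, z) \<in> zagier_set n. x + z \<noteq> y}. zagier_map t = t}
      = (\<lambda>d. (d, d, (n div d - d) div 4)) ` {d. d dvd n \<and> d\<^sup>2 < n}" (is "?F = ?g ` ?D")
  proof (intro subset_antisym subsetI)
    fix t assume t: "t \<in> ?F"
    then obtain x y z where [simp]: "t = (x, y, z)" by (cases t)
    have xyz: "0 < x" "0 < y" "0 < z" "x\<^sup>2 + 4 * y * z = n" "x + z \<noteq> y" "zagier_map (x, y, z) = (x, y, z)"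
      using t by (auto simp: zagier_set_def)
    \<comment> \<open>The first branch increases the first coordinate and the third decreases it, so
      only the middle branch can fix a triple.\<close>
    then have y: "y = x" by (auto split: if_splits)
    then have n_eq: "n = x * (x + 4 * z)" using xyz by (simp add: power2_eq_square algebra_simps)
    then have "n div x = x + 4 * z" using xyz(1) by simp
    then have "t = ?g x" using y by simp
    moreover have "x \<in> ?D" using n_eq xyz(1,3) by (simp add: power2_eq_square)
    ultimately show "t \<in> ?g ` ?D" by blast
  next
    fix t assume "t \<in> ?g ` ?D"
    then obtain d where d: "d dvd n" "d\<^sup>2 < n" "t = ?g d" by blast
    then obtain e where e: "n = d * e" by blast
    have d0: "0 < d" using n e by (auto simp: cong_def intro: Nat.gr0I)
    have "d < e" using d(2) e by (auto simp: power2_eq_square)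
    have "(d mod 4) * (e mod 4) mod 4 = 1" using n e by (simp add: cong_def mod_mult_eq)
    moreover have "d mod 4 \<in> {0,1,2,3}" "e mod 4 \<in> {0,1,2,3}" by auto
    ultimately have "d mod 4 = e mod 4" by auto
    then have "4 dvd e - d" using \<open>d < e\<close> by (metis mod_eq_dvd_iff_nat less_imp_le)
    then obtain z where z: "e = d + 4 * z" using \<open>d < e\<close>
      by (metis dvdE le_add_diff_inverse less_imp_le)
    then have "t = (d, d, z)" using d d0 e by simp
    then show "t \<in> ?F" using z e d0 \<open>d < e\<close>
      by (auto simp: zagier_set_def power2_eq_square algebra_simps)
  qed
  moreover have "inj_on ?g ?D" by (auto simp: inj_on_def)
  ultimately show ?thesis by (simp add: card_image)
qed

text \<open>The swap acts on all of \<open>zagier_set n\<close>, Zagier's map only off the boundary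
  \<open>x + z = y\<close>. Comparing the two parities therefore leaves the boundary as a correction
  term.\<close>

lemma parity_two_squares_pos:
  assumes n: "[n = 1] (mod 4)"
  shows "even (card {(x, y). 0 < x \<and> 0 < y \<and> x\<^sup>2 + 4 * y\<^sup>2 = n}) \<longleftrightarrow>
    even (card {d. d dvd n \<and> d\<^sup>2 < n} + card {(x, y, z) \<in> zagier_set n. x + z = y})"
proof -
  let ?T = "{(x, y, z) \<in> zagier_set n. x + z \<noteq> y}" and ?B = "{(x, y, z) \<in> zagier_set n. x + z = y}"
  have "odd n" using n by (simp add: cong_def) presburger
  have fin: "finite ?T" "finite ?B"
    by (auto intro: finite_subset[OF _ finite_zagier_set[of n]])
  have "even (card ?T) \<longleftrightarrow> even (card {t \<in> ?T. zagier_map t = t})"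
    using fin(1)
  proof (rule even_card_involution)
    fix t assume "t \<in> ?T"
    note involution = zagier_map_involution[OF \<open>odd n\<close> this]
    show "zagier_map t \<in> ?T" by (rule conjunct1[OF involution])
    show "zagier_map (zagier_map t) = t" by (rule conjunct2[OF involution])
  qed
  then have "even (card ?T) \<longleftrightarrow> even (card {d. d dvd n \<and> d\<^sup>2 < n})"
    unfolding zagier_map_fixed_points[OF n] .
  moreover have "card (zagier_set n) = card ?T + card ?B"
  proof -
    have "zagier_set n = ?T \<union> ?B" "?T \<inter> ?B = {}" by blast+
    then show ?thesis using card_Un_disjoint[OF fin] by presburger
  qed
  ultimately show ?thesis
    unfolding even_card_zagier_set_swap[symmetric] by simp
qed

lemma zagier_boundary_square:
  assumes "(x, y, z) \<in> zagier_set n" "x + z = y"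
  shows "n = (x + 2 * z)\<^sup>2"
proof -
  have "n = x\<^sup>2 + 4 * (x + z) * z" using assms by (simp add: zagier_set_def)
  then show ?thesis by (simp add: power2_eq_square algebra_simps)
qed

text \<open>On the boundary \<open>m = x + 2 * z\<close>, so \<open>z\<close> determines the triple,
  and the only constraints are \<open>0 < z\<close> and \<open>2 * z < m\<close>.\<close>

lemma card_zagier_boundary:
  assumes "odd m"
  shows "card {(x, y, z) \<in> zagier_set (m\<^sup>2). x + z = y} = m div 2"
proof -
  have "{(x, y, z) \<in> zagier_set (m\<^sup>2). x + z = y} = (\<lambda>z. (m - 2 * z, m - z, z)) ` {1..m div 2}"
    (is "?B = ?f ` _")
  proof (intro subset_antisym subsetI)
    fix t assume "t \<in> ?B"
    then obtain x y z where t: "t = (x, y, z)" "(x, y, z) \<in> zagier_set (m\<^sup>2)" "x + z = y" by blast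
    then have "m = x + 2 * z" using zagier_boundary_square by fastforce
    moreover have "0 < x" "0 < z" using t by (auto simp: zagier_set_def)
    ultimately have "t = ?f z" "z \<in> {1..m div 2}" using t by auto
    then show "t \<in> ?f ` {1..m div 2}" by (rule image_eqI)
  next
    fix t assume "t \<in> ?f ` {1..m div 2}"
    then obtain z where z: "t = ?f z" "1 \<le> z" "z \<le> m div 2" by auto
    \<comment> \<open>Oddness of \<open>m\<close> excludes equality.\<close>
    have "2 * z < m" using z(3) assms by presburger
    then obtain x where "m = x + 2 * z" "0 < x" by (metis add.commute less_imp_add_positive)
    then show "t \<in> ?B" using z by (auto simp: zagier_set_def power2_eq_square algebra_simps)
  qed
  moreover have "inj_on (\<lambda>z. (m - 2 * z, m - z, z)) {1..m div 2}" by (auto simp: inj_on_def)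
  ultimately show ?thesis by (simp add: card_image)
qed

section \<open>From representations \<open>x\<^sup>2 + 4 * y\<^sup>2\<close> to the number of
  divisors\<close>

lemma odd_card_two_squares_nonsquare:
  fixes n :: nat
  assumes n: "[n = 1] (mod 4)" and nsq: "\<not> (\<exists>k. n = k\<^sup>2)"
  shows "odd (card {(x, y). x\<^sup>2 + 4 * y\<^sup>2 = n}) \<longleftrightarrow> card {d. d dvd n} mod 4 = 2"
proof -
  have "odd n" using n by (simp add: cong_def) presburger
  have "x > 0 \<and> y > 0" if "x\<^sup>2 + 4 * y\<^sup>2 = n" for x y :: nat
  proof -
    have "x \<noteq> 0" using that \<open>odd n\<close> by (intro notI) auto
    moreover have "y \<noteq> 0" using that nsq by (intro notI) auto
    ultimately show ?thesis by simp
  qed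
  then have "{(x, y). x\<^sup>2 + 4 * y\<^sup>2 = n} = {(x, y). 0 < x \<and> 0 < y \<and> x\<^sup>2 + 4 * y\<^sup>2 = n}" by auto
  moreover have "{(x, y, z) \<in> zagier_set n. x + z = y} = {}"
    using zagier_boundary_square nsq by blast
  ultimately have "odd (card {(x, y). x\<^sup>2 + 4 * y\<^sup>2 = n}) \<longleftrightarrow> odd (card {d. d dvd n \<and> d\<^sup>2 < n})"
    using parity_two_squares_pos[OF n] by (simp only: card.empty add_0_right)
  moreover have "card {d. d dvd n} = 2 * card {d. d dvd n \<and> d\<^sup>2 < n}"
  proof -
    have "{d. d\<^sup>2 = n} = {}" using nsq by blast
    then show ?thesis using card_divisors_below_sqrt[of n] \<open>odd n\<close> by (simp add: odd_pos)
  qed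
  ultimately show ?thesis by presburger
qed

text \<open>The solution \<open>(m, 0)\<close> flips the parity, and the boundary contributes
  \<open>m div 2\<close>. With \<open>c\<close> the number of divisors below \<open>m\<close>, the
  product \<open>(2 * (m div 2) + 1) * (2 * c + 1)\<close> is \<open>2 * (c + m div 2) + 1\<close>
  modulo 4, so a single residue records both contributions.\<close>

lemma odd_card_two_squares_square:
  assumes "odd m"
  shows "odd (card {(x, y). x\<^sup>2 + 4 * y\<^sup>2 = m\<^sup>2}) \<longleftrightarrow> m * card {d. d dvd m\<^sup>2} mod 4 = 1"
proof -
  have n: "[m\<^sup>2 = 1] (mod 4)"
    using odd_square_mod_4[OF assms] by (simp add: cong_def)
  let ?P = "{(x, y). 0 < x \<and> 0 < y \<and> x\<^sup>2 + 4 * y\<^sup>2 = m\<^sup>2}"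
  let ?c = "card {d. d dvd m\<^sup>2 \<and> d\<^sup>2 < m\<^sup>2}"
  have "x > 0" if "x\<^sup>2 + 4 * y\<^sup>2 = m\<^sup>2" for x y :: nat
  proof (rule gr0I)
    assume "x = 0"
    then have "even (m\<^sup>2)" using that by (metis dvd_add dvd_mult2 even_numeral zero_power2 dvd_0_right)
    then show False using assms by simp
  qed
  then have "{(x, y). x\<^sup>2 + 4 * y\<^sup>2 = m\<^sup>2} = insert (m, 0) ?P" by force
  moreover have "finite ?P"
  proof (rule finite_subset)
    have "x \<le> m \<and> y \<le> m" if "x\<^sup>2 + 4 * y\<^sup>2 = m\<^sup>2" for x y
    proof -
      have "x\<^sup>2 \<le> m\<^sup>2" "y\<^sup>2 \<le> m\<^sup>2" using that by linarith+
      then show ?thesis by (simp add: power2_nat_le_eq_le)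
    qed
    then show "?P \<subseteq> {..m} \<times> {..m}" by auto
  qed simp
  ultimately have "card {(x, y). x\<^sup>2 + 4 * y\<^sup>2 = m\<^sup>2} = Suc (card ?P)" by simp
  then have parity: "odd (card {(x, y). x\<^sup>2 + 4 * y\<^sup>2 = m\<^sup>2}) \<longleftrightarrow> even (?c + m div 2)"
    using parity_two_squares_pos[OF n] by (simp add: card_zagier_boundary[OF assms])
  have "{d. d\<^sup>2 = m\<^sup>2} = {m}" by auto
  then have tau: "card {d. d dvd m\<^sup>2} = 2 * ?c + 1"
    using card_divisors_below_sqrt[of "m\<^sup>2"] assms by (simp add: odd_pos)
  have "m * card {d. d dvd m\<^sup>2} = (2 * (m div 2) + 1) * (2 * ?c + 1)"
    unfolding tau using assms by simp
  also have "\<dots> = 4 * (m div 2 * ?c) + (2 * (?c + m div 2) + 1)" by (simp add: algebra_simps)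
  finally have "m * card {d. d dvd m\<^sup>2} mod 4 = (2 * (?c + m div 2) + 1) mod 4" by simp
  also have "\<dots> = 1 \<longleftrightarrow> even (?c + m div 2)" by presburger
  finally show ?thesis unfolding parity by simp
qed

section \<open>Divisor counts modulo 4 in terms of prime exponents\<close>

lemma prod_mod_4:
  fixes f :: "'a \<Rightarrow> nat"
  assumes "finite A" "\<And>x. x \<in> A \<Longrightarrow> odd (f x)"
  shows "(\<Prod>x\<in>A. f x) mod 4 = (if even (card {x \<in> A. f x mod 4 = 3}) then 1 else 3)"
  using assms
proof (induction A rule: finite_induct)
  case (insert a A)
  let ?c = "card {x \<in> A. f x mod 4 = 3}"
  have IH: "prod f A mod 4 = (if even ?c then 1 else 3)" using insert by simp
  have "f a mod 4 = 1 \<or> f a mod 4 = 3" using insert.prems[of a] by simp presburger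
  then show ?case
  proof
    assume a: "f a mod 4 = 1"
    then have "{x \<in> insert a A. f x mod 4 = 3} = {x \<in> A. f x mod 4 = 3}" by auto
    moreover have "prod f (insert a A) mod 4 = (f a mod 4) * (prod f A mod 4) mod 4"
      using insert.hyps by (simp add: mod_mult_eq)
    ultimately show ?thesis using a IH by simp
  next
    assume a: "f a mod 4 = 3"
    then have "{x \<in> insert a A. f x mod 4 = 3} = insert a {x \<in> A. f x mod 4 = 3}" by auto
    then have "card {x \<in> insert a A. f x mod 4 = 3} = Suc ?c" using insert.hyps by simp
    moreover have "prod f (insert a A) mod 4 = (f a mod 4) * (prod f A mod 4) mod 4"
      using insert.hyps by (simp add: mod_mult_eq)
    ultimately show ?thesis using a IH by simp
  qed
qed simp

lemma power_3_mod_4: "(3::nat) ^ k mod 4 = (if even k then 1 else 3)"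
proof (induction k)
  case (Suc k)
  have "(3::nat) ^ Suc k mod 4 = 3 * (3 ^ k mod 4) mod 4" by (simp add: mod_mult_right_eq)
  then show ?case unfolding Suc.IH by simp
qed simp

text \<open>Both \<open>m\<close> and the divisor count of \<open>m\<^sup>2\<close> are products
  over the primes of \<open>m\<close>. Merged, they have one odd factor per prime, and the residue
  modulo 4 is a sign: it counts the factors congruent to 3.\<close>

lemma card_divisors_square_mod_4:
  fixes m :: nat
  assumes "odd m"
  shows "m * card {d. d dvd m\<^sup>2} mod 4 = 1 \<longleftrightarrow>
    even (card {p. prime p \<and> [p = 1] (mod 4) \<and> [multiplicity p (m\<^sup>2) = 2] (mod 4)})"
proof -
  let ?k = "\<lambda>p. multiplicity p m"
  let ?f = "\<lambda>p. p ^ ?k p * (2 * ?k p + 1)"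
  have m0: "m > 0" using assms by (rule odd_pos)
  have mult: "multiplicity p (m\<^sup>2) = 2 * ?k p" if "prime p" for p
    using that m0 by (simp add: prime_elem_multiplicity_power_distrib)
  have P: "prime_factors (m\<^sup>2) = prime_factors m" by (simp add: prime_factors_power)
  have odd_p: "odd p" if "p \<in> prime_factors m" for p
    using that assms by (meson dvd_trans in_prime_factors_imp_dvd)
  have "card {d. d dvd m\<^sup>2} = (\<Prod>p\<in>prime_factors m. 2 * ?k p + 1)"
    using m0 unfolding card_divisors[OF zero_less_power[OF m0]] P
    by (intro prod.cong refl) (simp add: mult in_prime_factors_imp_prime)
  moreover have "m = (\<Prod>p\<in>prime_factors m. p ^ ?k p)" using m0 by (simp add: prod_prime_factors)
  \<comment> \<open>For \<open>p\<close> congruent to 3 modulo 4 the factor \<open>p ^ k * (2 * k + 1)\<close> is always 1 modulo 4: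
    the two signs cancel, which is why only primes congruent to 1 survive.\<close>
  ultimately have "m * card {d. d dvd m\<^sup>2} = (\<Prod>p\<in>prime_factors m. ?f p)"
    by (metis prod.distrib)
  then have "m * card {d. d dvd m\<^sup>2} mod 4 = (if even (card {p \<in> prime_factors m. ?f p mod 4 = 3}) then 1 else 3)"
    using prod_mod_4[of "prime_factors m" ?f] odd_p by simp
  moreover have "{p \<in> prime_factors m. ?f p mod 4 = 3} =
      {p. prime p \<and> [p = 1] (mod 4) \<and> [multiplicity p (m\<^sup>2) = 2] (mod 4)}"
  proof -
    have "?f p mod 4 = 3 \<longleftrightarrow> p mod 4 = 1 \<and> odd (?k p)" if p: "p \<in> prime_factors m" for p
    proof -
      have "p mod 4 = 1 \<or> p mod 4 = 3" using odd_p[OF p] by presburger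
      then show ?thesis
      proof
        assume p1: "p mod 4 = 1"
        have "?f p mod 4 = (p mod 4) ^ ?k p * (2 * ?k p + 1) mod 4"
          by (metis mod_mult_left_eq power_mod)
        then have "?f p mod 4 = (2 * ?k p + 1) mod 4" by (simp add: p1)
        also have "\<dots> = 3 \<longleftrightarrow> odd (?k p)" by presburger
        finally show ?thesis using p1 by simp
      next
        assume p3: "p mod 4 = 3"
        have "?f p mod 4 = ((p mod 4) ^ ?k p mod 4) * (2 * ?k p + 1) mod 4"
          by (metis mod_mult_left_eq power_mod)
        then have f: "?f p mod 4 = (if even (?k p) then 1 else 3) * (2 * ?k p + 1) mod 4"
          unfolding p3 power_3_mod_4 .
        show ?thesis
        proof (cases "even (?k p)")
          case True
          then have "(2 * ?k p + 1) mod 4 = 1" by presburger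
          then show ?thesis using True p3 f by simp
        next
          case False
          then have "3 * (2 * ?k p + 1) mod 4 = 1" by presburger
          then show ?thesis using False p3 f by simp
        qed
      qed
    qed
    moreover have "[multiplicity p (m\<^sup>2) = 2] (mod 4) \<longleftrightarrow> odd (?k p)" if "prime p" for p
      unfolding mult[OF that] cong_def by presburger
    \<comment> \<open>An odd exponent is nonzero, so the primes being counted all lie in the finite
      set \<open>prime_factors m\<close>.\<close>
    moreover have "p \<in> prime_factors m" if "prime p" "odd (?k p)" for p
      using that by (auto simp: prime_factors_multiplicity intro: odd_pos)
    ultimately show ?thesis by (auto simp: cong_def)
  qed
  ultimately show ?thesis by simp
qed

text \<open>A product of the numbers \<open>multiplicity p n + 1\<close> is 2 modulo 4 iff exactly
  one factor is even and that factor is itself 2 modulo 4. The residue of \<open>p0\<close> is then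
  read off from \<open>n = p0 * s\<^sup>2\<close> with \<open>s\<close> odd.\<close>

lemma card_divisors_mod_4_eq_2_iff:
  fixes n :: nat
  assumes n: "[n = 1] (mod 4)"
  shows "card {d. d dvd n} mod 4 = 2 \<longleftrightarrow>
    (\<exists>p0. prime p0 \<and> odd (multiplicity p0 n) \<and>
      (\<forall>p. prime p \<and> p \<noteq> p0 \<longrightarrow> even (multiplicity p n)) \<and>
      [p0 = 1] (mod 4) \<and> [multiplicity p0 n = 1] (mod 4))" (is "_ \<longleftrightarrow> ?R")
proof -
  let ?\<nu> = "\<lambda>p. multiplicity p n"
  let ?P = "prime_factors n"
  have "odd n" using n by (simp add: cong_def) presburger
  then have n0: "n > 0" by (rule odd_pos)
  have tau: "card {d. d dvd n} = (?\<nu> p + 1) * (\<Prod>q\<in>?P - {p}. ?\<nu> q + 1)" if "p \<in> ?P" for p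
    using that n0 by (simp add: card_divisors prod.remove)
  show ?thesis
  proof
    assume ?R
    then obtain p0 where p0: "prime p0" "odd (?\<nu> p0)" "[?\<nu> p0 = 1] (mod 4)"
      and even: "\<And>p. prime p \<Longrightarrow> p \<noteq> p0 \<Longrightarrow> even (?\<nu> p)" by blast
    have "p0 \<in> ?P" using p0 by (auto simp: prime_factors_multiplicity intro: odd_pos)
    moreover have "odd (\<Prod>q\<in>?P - {p0}. ?\<nu> q + 1)"
      using even by (auto simp: even_prod_iff)
    then obtain j where "(\<Prod>q\<in>?P - {p0}. ?\<nu> q + 1) = 2 * j + 1" by (rule oddE)
    moreover have "(?\<nu> p0 + 1) mod 4 = 2" using p0(3) unfolding cong_def by presburger
    then obtain i where "?\<nu> p0 + 1 = 4 * i + 2" by (metis mult_div_mod_eq)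
    ultimately have "card {d. d dvd n} = (4 * i + 2) * (2 * j + 1)" using tau by metis
    also have "\<dots> = 4 * (i * (2 * j + 1) + j) + 2" by (simp add: algebra_simps)
    finally obtain k where "card {d. d dvd n} = 4 * k + 2" by blast
    then show "card {d. d dvd n} mod 4 = 2" by presburger
  next
    assume mod4: "card {d. d dvd n} mod 4 = 2"
    then have "even (card {d. d dvd n})" by presburger
    then obtain p0 where p0: "p0 \<in> ?P" "even (?\<nu> p0 + 1)"
      using n0 by (auto simp: card_divisors even_prod_iff)
    \<comment> \<open>A second even factor would make the divisor count a multiple of 4.\<close>
    have rest: "odd (\<Prod>q\<in>?P - {p0}. ?\<nu> q + 1)"
    proof
      assume "even (\<Prod>q\<in>?P - {p0}. ?\<nu> q + 1)"
      then have "2 * 2 dvd card {d. d dvd n}" unfolding tau[OF p0(1)] using p0(2) by (intro mult_dvd_mono)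
      then show False using mod4 by simp
    qed
    have even: "even (?\<nu> p)" if "prime p" "p \<noteq> p0" for p
    proof (cases "p \<in> ?P")
      case True
      then show ?thesis using rest that by (auto simp: even_prod_iff)
    next
      case False
      then show ?thesis using that by (auto simp: prime_factors_multiplicity)
    qed
    have nu: "[?\<nu> p0 = 1] (mod 4)"
    proof -
      have "\<not> 4 dvd ?\<nu> p0 + 1"
      proof
        assume "4 dvd ?\<nu> p0 + 1"
        then have "4 dvd card {d. d dvd n}" unfolding tau[OF p0(1)] by (rule dvd_mult2)
        then show False using mod4 by simp
      qed
      then show ?thesis using p0(2) unfolding cong_def by presburger
    qed
    have "[p0 = 1] (mod 4)"
    proof -
      obtain j where j: "?\<nu> p0 = 2 * j + 1" using p0(2) by (auto elim: oddE)
      \<comment> \<open>Halving the even exponents gives a root of the part of \<open>n\<close>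
        prime to \<open>p0\<close>; together with \<open>p0 ^ j\<close> it gives a root of
        \<open>n\<close> divided by \<open>p0\<close>.\<close>
      define r where "r = (\<Prod>p\<in>?P - {p0}. p ^ (?\<nu> p div 2))"
      have "(\<Prod>p\<in>?P - {p0}. p ^ ?\<nu> p) = r\<^sup>2"
        unfolding r_def prod_power_distrib
      proof (intro prod.cong refl)
        fix p assume "p \<in> ?P - {p0}"
        then have "even (?\<nu> p)" using even in_prime_factors_imp_prime by blast
        then show "p ^ ?\<nu> p = (p ^ (?\<nu> p div 2))\<^sup>2" by (simp flip: power_mult)
      qed
      moreover have "n = p0 ^ ?\<nu> p0 * (\<Prod>p\<in>?P - {p0}. p ^ ?\<nu> p)"
        using n0 p0(1) by (subst prod.remove[symmetric]) (simp_all add: prod_prime_factors)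
      ultimately have "n = p0 * (p0 ^ j * r)\<^sup>2"
        by (simp add: j power_mult_distrib power_add mult_ac flip: power_mult)
      then obtain s where s: "n = p0 * s\<^sup>2" by blast
      then have "odd s" using \<open>odd n\<close> by auto
      then obtain i where "s = 2 * i + 1" by (rule oddE)
      \<comment> \<open>An odd square is 1 modulo 4, so \<open>n\<close> and \<open>p0\<close> agree
        modulo 4.\<close>
      then have "n = p0 + 4 * (p0 * (i\<^sup>2 + i))" using s by (simp add: power2_eq_square algebra_simps)
      then show ?thesis using n unfolding cong_def by (metis mod_mult_self2)
    qed
    then show ?R using p0 even nu by auto
  qed
qed

section \<open>The three cases of the description of the reciprocal\<close>

theorem theorem6p2:
  fixes S :: "nat set" and n :: nat
  assumes "S = {k\<^sup>2 | k :: nat. True}"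
  shows
    "(even n \<longrightarrow>
        (n \<in> reciprocal S \<longleftrightarrow> (\<exists>k :: nat. n = 2 * k\<^sup>2))) \<and>
     ([n = 1] (mod 4) \<and> \<not> (\<exists>k :: nat. n = k\<^sup>2) \<longrightarrow>
        (n \<in> reciprocal S \<longleftrightarrow>
          (\<exists>p0. prime p0 \<and> odd (multiplicity p0 n) \<and>
            (\<forall>p. prime p \<and> p \<noteq> p0 \<longrightarrow> even (multiplicity p n)) \<and>
            [p0 = 1] (mod 4) \<and> [multiplicity p0 n = 1] (mod 4)))) \<and>
     ([n = 1] (mod 4) \<and> (\<exists>k :: nat. n = k\<^sup>2) \<longrightarrow>
        (n \<in> reciprocal S \<longleftrightarrow>
          even (card {p. prime p \<and> [p = 1] (mod 4) \<and> [multiplicity p n = 2] (mod 4)})))"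
proof (intro conjI impI)
  note S = assms
  show "n \<in> reciprocal S \<longleftrightarrow> (\<exists>k. n = 2 * k\<^sup>2)" if "even n"
    using even_mem_reciprocal_squares[OF S that] .
  show "n \<in> reciprocal S \<longleftrightarrow>
      (\<exists>p0. prime p0 \<and> odd (multiplicity p0 n) \<and>
        (\<forall>p. prime p \<and> p \<noteq> p0 \<longrightarrow> even (multiplicity p n)) \<and>
        [p0 = 1] (mod 4) \<and> [multiplicity p0 n = 1] (mod 4))"
    if "[n = 1] (mod 4) \<and> \<not> (\<exists>k. n = k\<^sup>2)"
    unfolding mem_reciprocal_squares_1_mod_4[OF S conjunct1[OF that]]
      odd_card_two_squares_nonsquare[OF conjunct1[OF that] conjunct2[OF that]]
    by (rule card_divisors_mod_4_eq_2_iff[OF conjunct1[OF that]])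
  show "n \<in> reciprocal S \<longleftrightarrow>
      even (card {p. prime p \<and> [p = 1] (mod 4) \<and> [multiplicity p n = 2] (mod 4)})"
    if n: "[n = 1] (mod 4) \<and> (\<exists>k. n = k\<^sup>2)"
  proof -
    obtain m where m: "n = m\<^sup>2" using n by blast
    have "odd n" using conjunct1[OF n] by (simp add: cong_def) presburger
    then have "odd m" using m by simp
    then show ?thesis
      using mem_reciprocal_squares_1_mod_4[OF S conjunct1[OF n]]
        odd_card_two_squares_square card_divisors_square_mod_4
      unfolding m by blast
  qed
qed

end
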